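(* Let $s(n)$ denote the number of maximal independent sets of the square cactus $S(n)$. Then $s(1)=2$ and $s(n)=2s(n-1)$ for all $n\ge 2$; that is, $s(n)=2^n$ for all $n\ge 1$.
   Context: For $n\ge 1$, the square (ortho-rectangular) cactus $S(n)$ is the graph formed by a chain of $n$ 4-cycles $B_1,\dots,B_n$, where for each $1\le i\le n-1$ the consecutive cycles $B_i$ and $B_{i+1}$ share exactly one vertex, non-consecutive cycles share no vertex, every vertex lies in at most two cycles, and for each $2\le i\le n-1$ the two shared (cut) vertices of $B_i$ are adjacent. An independent set is maximal if no further vertex can be added while keeping it independent. *)

theory Defs
  imports "Graph_Theory.Pair_Digraph"
begin

definition independent_set :: "'a pair_pre_digraph \<Rightarrow> 'a set \<Rightarrow> bool" where
  "independent_set G I \<longleftrightarrow>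
     I \<subseteq> pverts G \<and> (\<forall>u\<in>I. \<forall>v\<in>I. (u, v) \<notin> parcs G)"

definition maximal_independent_set :: "'a pair_pre_digraph \<Rightarrow> 'a set \<Rightarrow> bool" where
  "maximal_independent_set G I \<longleftrightarrow>
     independent_set G I \<and>
     (\<forall>v \<in> pverts G - I. \<not> independent_set G (insert v I))"

definition num_maximal_independent_sets :: "'a pair_pre_digraph \<Rightarrow> nat" where
  "num_maximal_independent_sets G = card {I. maximal_independent_set G I}"

(* Undirected graphs are symmetric digraphs: each edge contributes both of its arcs. *)
definition four_cycle :: "'a pair_pre_digraph \<Rightarrow> bool" where
  "four_cycle B \<longleftrightarrow>
     (\<exists>a b c d. distinct [a, b, c, d] \<and>
        B = \<lparr> pverts = {a, b, c, d},
              parcs = {(a, b), (b, a), (b, c), (c, b), (c, d), (d, c), (d, a), (a, d)} \<rparr>)"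

(* The square cactus is determined only up to isomorphism, so it is given as a predicate on
   graphs, quantifying over the chain B 1, ..., B n of its 4-cycles. *)
definition square_cactus :: "nat \<Rightarrow> 'a pair_pre_digraph \<Rightarrow> bool" where
  "square_cactus n G \<longleftrightarrow> n \<ge> 1 \<and>
     (\<exists>B :: nat \<Rightarrow> 'a pair_pre_digraph.
        (\<forall>i\<in>{1..n}. four_cycle (B i)) \<and>
        pverts G = (\<Union>i\<in>{1..n}. pverts (B i)) \<and>
        parcs G = (\<Union>i\<in>{1..n}. parcs (B i)) \<and>
        (\<forall>i\<in>{1..<n}. card (pverts (B i) \<inter> pverts (B (i + 1))) = 1) \<and>
        (\<forall>i\<in>{1..n}. \<forall>j\<in>{1..n}. i + 1 < j \<longrightarrow> pverts (B i) \<inter> pverts (B j) = {}) \<and>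
        (\<forall>v\<in>pverts G. card {i\<in>{1..n}. v \<in> pverts (B i)} \<le> 2) \<and>
        (\<forall>i\<in>{2..<n}. \<forall>u \<in> pverts (B (i - 1)) \<inter> pverts (B i).
            \<forall>v \<in> pverts (B i) \<inter> pverts (B (i + 1)). (u, v) \<in> parcs G))"

lemma square_cactus_pair_graph:
  assumes "square_cactus n G"
  shows "pair_graph G"
proof -
  obtain B where c: "\<And>i. i \<in> {1..n} \<Longrightarrow> four_cycle (B i)"
    and V: "pverts G = (\<Union>i\<in>{1..n}. pverts (B i))"
    and E: "parcs G = (\<Union>i\<in>{1..n}. parcs (B i))"
    using assms unfolding square_cactus_def by (elim conjE exE) (rule that; simp only: Ball_def)
  have fin: "finite (pverts H) \<and> finite (parcs H)"
    and wf': "\<forall>e\<in>parcs H. fst e \<in> pverts H \<and> snd e \<in> pverts H \<and> fst e \<noteq> snd e \<and>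
      (snd e, fst e) \<in> parcs H"
    if H: "four_cycle H" for H :: "'a pair_pre_digraph"
  proof -
    obtain a b c d where *: "distinct [a, b, c, d]" "H = \<lparr> pverts = {a, b, c, d},
        parcs = {(a, b), (b, a), (b, c), (c, b), (c, d), (d, c), (d, a), (a, d)} \<rparr>"
      using H unfolding four_cycle_def by blast
    then have "a \<noteq> b" "b \<noteq> a" "b \<noteq> c" "c \<noteq> b" "c \<noteq> d" "d \<noteq> c" "a \<noteq> d" "d \<noteq> a"
      by auto
    then show "\<forall>e\<in>parcs H. fst e \<in> pverts H \<and> snd e \<in> pverts H \<and> fst e \<noteq> snd e \<and>
        (snd e, fst e) \<in> parcs H"
      unfolding *(2) by simp
    show "finite (pverts H) \<and> finite (parcs H)" unfolding *(2) by simp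
  qed
  have wf: "fst e \<in> pverts (B i) \<and> snd e \<in> pverts (B i) \<and> fst e \<noteq> snd e \<and>
      (snd e, fst e) \<in> parcs (B i)" if "i \<in> {1..n}" "e \<in> parcs (B i)" for i e
    using wf'[OF c[OF that(1)]] that(2) by blast
  show ?thesis
  proof
    show "finite (pverts G)" "finite (parcs G)" unfolding V E using fin c by blast+
    have "(v, u) \<in> parcs G" if uv: "(u, v) \<in> parcs G" for u v
    proof -
      obtain i where "i \<in> {1..n}" "(u, v) \<in> parcs (B i)" using uv unfolding E by blast
      then show ?thesis unfolding E using wf[of i "(u, v)"] by auto
    qed
    then show "symmetric G" unfolding symmetric_def by (simp add: sym_def)
    fix e assume "e \<in> parcs G"
    then obtain i where "i \<in> {1..n}" "e \<in> parcs (B i)" unfolding E by blast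
    with wf[of i e] show "fst e \<in> pverts G" "snd e \<in> pverts G" "fst e \<noteq> snd e"
      unfolding V by blast+
  qed
qed

(* Non-vacuity: block i has the vertices 3i-3, ..., 3i, and consecutive blocks i, i+1 share 3i. *)
lemma square_cactus_exists:
  assumes "n \<ge> 1"
  shows "\<exists>G :: nat pair_pre_digraph. square_cactus n G"
proof -
  define B :: "nat \<Rightarrow> nat pair_pre_digraph" where
    "B i = (let a = 3*i-3; b = 3*i; c = 3*i-1; d = 3*i-2 in
        \<lparr> pverts = {a, b, c, d},
          parcs = {(a, b), (b, a), (b, c), (c, b), (c, d), (d, c), (d, a), (a, d)} \<rparr>)" for i
  define G where "G = \<lparr> pverts = (\<Union>i\<in>{1..n}. pverts (B i)), parcs = (\<Union>i\<in>{1..n}. parcs (B i)) \<rparr>"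
  have V: "pverts (B i) = {3*i-3..3*i}" if "i \<ge> 1" for i
    using that by (auto simp: B_def Let_def)
  have A: "(3*i-3, 3*i) \<in> parcs (B i)" for i
    by (auto simp: B_def Let_def)
  have share: "pverts (B i) \<inter> pverts (B (i+1)) = {3*i}" if "i \<ge> 1" for i
    using that by (auto simp: V)
  have "four_cycle (B i)" if "i \<ge> 1" for i
    unfolding four_cycle_def
  proof (intro exI conjI)
    show "distinct [3*i-3, 3*i, 3*i-1, 3*i-2]" using that by auto
  qed (simp add: B_def Let_def)
  moreover have "card {i\<in>{1..n}. v \<in> pverts (B i)} \<le> 2" for v
  proof -
    have "{i\<in>{1..n}. v \<in> pverts (B i)} \<subseteq> {(v+2) div 3, (v+2) div 3 + 1}"
      by (auto simp: V)
    from card_mono[OF _ this] show ?thesis by simp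
  qed
  moreover have "(u, v) \<in> parcs G"
    if "i \<in> {2..<n}" "u \<in> pverts (B (i - 1)) \<inter> pverts (B i)"
       "v \<in> pverts (B i) \<inter> pverts (B (i + 1))" for i u v
  proof -
    have "i - 1 \<ge> 1" "i - 1 + 1 = i" "3 * (i - 1) = 3*i-3" using that(1) by auto
    with share[of "i - 1"] have "pverts (B (i - 1)) \<inter> pverts (B i) = {3*i-3}" by metis
    with that(2) have "u = 3*i-3" by blast
    moreover have "i \<ge> 1" using that(1) by simp
    with that(3) share have "v = 3*i" by blast
    ultimately show ?thesis using A[of i] that(1) by (auto simp: G_def)
  qed
  moreover have "pverts (B i) \<inter> pverts (B j) = {}" if "i \<ge> 1" "i + 1 < j" for i j
    using that by (auto simp: V)
  moreover have "card (pverts (B i) \<inter> pverts (B (i+1))) = 1" if "i \<ge> 1" for i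
    using share[OF that] by simp
  moreover have "pverts G = (\<Union>i\<in>{1..n}. pverts (B i))" "parcs G = (\<Union>i\<in>{1..n}. parcs (B i))"
    by (simp_all add: G_def)
  ultimately have "square_cactus n G"
    unfolding square_cactus_def atLeastAtMost_iff atLeastLessThan_iff Ball_def using assms
    by blast
  then show ?thesis ..
qed

end

theory Submission
  imports Defs
begin

text \<open>
  Let a 4-cycle \<open>u a b c\<close> be glued to a graph \<open>H\<close> at the vertex \<open>u\<close>. A maximal independent set of
  the result either contains \<open>b\<close>, hence neither \<open>a\<close> nor \<open>c\<close>, and is \<open>b\<close> together with a maximal
  independent set of \<open>H\<close>; or it avoids \<open>b\<close>, hence contains \<open>a\<close> and \<open>c\<close> and not \<open>u\<close>, and is
  \<open>{a, c}\<close> together with a maximal independent set of \<open>H - u\<close>. After deletion of \<open>a\<close> the same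
  dichotomy holds with \<open>{c}\<close> in place of \<open>{a, c}\<close>. So both the new graph and the new graph without
  \<open>a\<close> have \<open>s(H) + s(H - u)\<close> maximal independent sets. As the cut vertices of a square are
  adjacent, the next square is glued at a vertex playing the role of \<open>a\<close>, and both counts
  double at every step.
\<close>

text \<open>
  Only the arcs of \<open>E\<close> inside \<open>V\<close> matter, so a vertex is deleted by removing it from \<open>V\<close> alone.
\<close>
definition mis :: "'a set \<Rightarrow> 'a rel \<Rightarrow> 'a set set" where
  "mis V E = {I. I \<subseteq> V \<and> (\<forall>x\<in>V. x \<in> I \<longleftrightarrow> (\<forall>y\<in>I. (x, y) \<notin> E))}"

abbreviation square_arcs :: "'a \<Rightarrow> 'a \<Rightarrow> 'a \<Rightarrow> 'a \<Rightarrow> 'a rel" where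
  "square_arcs a b c d \<equiv> {(a, b), (b, a), (b, c), (c, b), (c, d), (d, c), (d, a), (a, d)}"

lemma misI:
  "I \<subseteq> V \<Longrightarrow> (\<And>x. x \<in> V \<Longrightarrow> x \<in> I \<longleftrightarrow> (\<forall>y\<in>I. (x, y) \<notin> E)) \<Longrightarrow> I \<in> mis V E"
  by (simp add: mis_def)

lemma mis_subset: "I \<in> mis V E \<Longrightarrow> I \<subseteq> V"
  by (simp add: mis_def)

lemma mem_mis_iff: "I \<in> mis V E \<Longrightarrow> x \<in> V \<Longrightarrow> x \<in> I \<longleftrightarrow> (\<forall>y\<in>I. (x, y) \<notin> E)"
  unfolding mis_def mem_Collect_eq by (elim conjE) (rule bspec)

lemma maximal_independent_sets_eq_mis:
  assumes "pair_graph G"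
  shows "{I. maximal_independent_set G I} = mis (pverts G) (parcs G)"
proof -
  interpret pair_graph G by fact
  have sym: "(x, y) \<in> parcs G \<longleftrightarrow> (y, x) \<in> parcs G" for x y
    by (rule arcs_symmetric[THEN iffI, OF _ arcs_symmetric])
  have irrefl: "(x, x) \<notin> parcs G" for x
    using no_loops[of "(x, x)"] by auto
  show ?thesis
    unfolding maximal_independent_set_def independent_set_def mis_def
    using sym irrefl by (intro Collect_cong) blast
qed

lemma finite_mis: "finite V \<Longrightarrow> finite (mis V E)"
  by (rule finite_subset[of _ "Pow V"]) (auto simp: mis_def)

lemma card_mis_glue:
  assumes "finite V" and X: "X \<inter> V = {}" and Y: "Y \<inter> V = {}" and "X \<noteq> Y"
    and eq: "M = (\<union>) X ` mis V E \<union> (\<union>) Y ` mis (V - {u}) E"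
  shows "card M = card (mis V E) + card (mis (V - {u}) E)"
proof -
  have X': "(X \<union> I) \<inter> V = I" "(X \<union> I) - V = X" if "I \<in> mis V E" for I
    using that X by (auto simp: mis_def)
  have Y': "(Y \<union> I) \<inter> V = I" "(Y \<union> I) - V = Y" if "I \<in> mis (V - {u}) E" for I
    using that Y by (auto simp: mis_def)
  have "inj_on ((\<union>) X) (mis V E)" "inj_on ((\<union>) Y) (mis (V - {u}) E)"
    by (metis X'(1) inj_onI) (metis Y'(1) inj_onI)
  moreover have "(\<union>) X ` mis V E \<inter> (\<union>) Y ` mis (V - {u}) E = {}"
    using X'(2) Y'(2) \<open>X \<noteq> Y\<close> by (metis (no_types, lifting) disjoint_iff imageE)
  ultimately show ?thesis
    unfolding eq using \<open>finite V\<close> by (simp add: card_Un_disjoint finite_mis card_image)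
qed

text \<open>
  The set \<open>W\<close> is \<open>{a}\<close> for the glued graph and empty for the glued graph without \<open>a\<close>.
\<close>
lemma card_mis_glue_square:
  assumes "finite V" and E: "E \<subseteq> V \<times> V" and u: "u \<in> V"
    and new: "a \<notin> V" "b \<notin> V" "c \<notin> V" and dist: "distinct [a, b, c]" and W: "W \<subseteq> {a}"
  shows "card (mis (V \<union> {b, c} \<union> W) (E \<union> square_arcs u a b c)) =
    card (mis V E) + card (mis (V - {u}) E)" (is "card (mis ?V ?E) = _")
proof (rule card_mis_glue[OF \<open>finite V\<close>, where X = "{b}" and Y = "{c} \<union> W"])
  have ne: "u \<noteq> a" "u \<noteq> b" "u \<noteq> c" "a \<noteq> b" "a \<noteq> c" "b \<noteq> c" using u new dist by auto
  have nV: "(x, y) \<notin> E" if "x \<notin> V \<or> y \<notin> V" for x y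
    using that E by auto
  have arc_a: "(a, y) \<in> ?E \<longleftrightarrow> y = u \<or> y = b" for y using ne new by (auto simp: nV)
  have arc_b: "(b, y) \<in> ?E \<longleftrightarrow> y = a \<or> y = c" for y using ne new by (auto simp: nV)
  have arc_c: "(c, y) \<in> ?E \<longleftrightarrow> y = b \<or> y = u" for y using ne new by (auto simp: nV)
  have arc_V: "(x, y) \<in> ?E \<longleftrightarrow> (x, y) \<in> E \<or> x = u \<and> (y = a \<or> y = c)" if "x \<in> V" for x y
  proof -
    have "x \<noteq> a" "x \<noteq> b" "x \<noteq> c" using that new by auto
    then show ?thesis by auto
  qed
  have mis_iff: "I \<in> mis ?V ?E \<longleftrightarrow> I \<subseteq> ?V \<and> (b \<in> I \<longleftrightarrow> a \<notin> I \<and> c \<notin> I) \<and>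
      (c \<in> I \<longleftrightarrow> b \<notin> I \<and> u \<notin> I) \<and> (W = {a} \<longrightarrow> (a \<in> I \<longleftrightarrow> u \<notin> I \<and> b \<notin> I)) \<and>
      (\<forall>x\<in>V. x \<in> I \<longleftrightarrow> (\<forall>y\<in>I \<inter> V. (x, y) \<notin> E) \<and> (x = u \<longrightarrow> a \<notin> I \<and> c \<notin> I))" for I
  proof -
    have nbr_V: "(\<forall>y\<in>I. (x, y) \<notin> ?E) \<longleftrightarrow>
        (\<forall>y\<in>I \<inter> V. (x, y) \<notin> E) \<and> (x = u \<longrightarrow> a \<notin> I \<and> c \<notin> I)" if "x \<in> V" for x
      unfolding arc_V[OF that] using nV by blast
    have nbr_abc: "(\<forall>y\<in>I. (a, y) \<notin> ?E) \<longleftrightarrow> u \<notin> I \<and> b \<notin> I"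
      "(\<forall>y\<in>I. (b, y) \<notin> ?E) \<longleftrightarrow> a \<notin> I \<and> c \<notin> I"
      "(\<forall>y\<in>I. (c, y) \<notin> ?E) \<longleftrightarrow> b \<notin> I \<and> u \<notin> I"
      unfolding arc_a arc_b arc_c by blast+
    have split: "(\<forall>x\<in>?V. P x) \<longleftrightarrow> P b \<and> P c \<and> (W = {a} \<longrightarrow> P a) \<and> (\<forall>x\<in>V. P x)" for P
      using W by auto
    show ?thesis
      unfolding mis_def mem_Collect_eq split nbr_abc by (simp only: nbr_V cong: ball_cong)
  qed
  show "mis ?V ?E = (\<union>) {b} ` mis V E \<union> (\<union>) ({c} \<union> W) ` mis (V - {u}) E"
  proof (intro equalityI subsetI)
    fix I assume I: "I \<in> mis ?V ?E"
    have "I \<subseteq> ?V" using I unfolding mis_iff by blast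
    have ker: "x \<in> I \<inter> V \<longleftrightarrow> (\<forall>y\<in>I \<inter> V. (x, y) \<notin> E)"
      if "x \<in> V" "x \<noteq> u \<or> a \<notin> I \<and> c \<notin> I" for x
    proof -
      have "x \<in> I \<longleftrightarrow> (\<forall>y\<in>I \<inter> V. (x, y) \<notin> E) \<and> (x = u \<longrightarrow> a \<notin> I \<and> c \<notin> I)"
        using I \<open>x \<in> V\<close> unfolding mis_iff by (elim conjE) (rule bspec)
      moreover have "x = u \<longrightarrow> a \<notin> I \<and> c \<notin> I" using that(2) by blast
      ultimately show ?thesis using \<open>x \<in> V\<close> by blast
    qed
    show "I \<in> (\<union>) {b} ` mis V E \<union> (\<union>) ({c} \<union> W) ` mis (V - {u}) E"
    proof (cases "b \<in> I")
      case True
      then have "a \<notin> I" "c \<notin> I" using I unfolding mis_iff by blast+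
      then have "I = {b} \<union> (I \<inter> V)" using True \<open>I \<subseteq> ?V\<close> W by blast
      moreover have "I \<inter> V \<in> mis V E"
        by (intro misI ker) (use \<open>a \<notin> I\<close> \<open>c \<notin> I\<close> in auto)
      ultimately show ?thesis by blast
    next
      case False
      have "c \<in> I" "u \<notin> I" "W \<subseteq> I" "a \<in> I \<Longrightarrow> a \<in> W"
        using I False W new ne unfolding mis_iff by auto
      then have "I = ({c} \<union> W) \<union> (I \<inter> V)" using False \<open>I \<subseteq> ?V\<close> W by blast
      moreover have "I \<inter> V \<in> mis (V - {u}) E"
        by (intro misI ker) (use \<open>u \<notin> I\<close> in auto)
      ultimately show ?thesis by blast
    qed
  next
    fix I assume "I \<in> (\<union>) {b} ` mis V E \<union> (\<union>) ({c} \<union> W) ` mis (V - {u}) E"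
    then show "I \<in> mis ?V ?E"
    proof
      assume "I \<in> (\<union>) {b} ` mis V E"
      then obtain J where J: "I = {b} \<union> J" "J \<in> mis V E" by blast
      note JV = mis_subset[OF J(2)]
      have I: "I \<inter> V = J" "a \<notin> I" "c \<notin> I" "b \<in> I" "\<And>x. x \<in> V \<Longrightarrow> x \<in> I \<longleftrightarrow> x \<in> J"
        using J(1) JV new ne by auto
      have "x \<in> I \<longleftrightarrow> (\<forall>y\<in>I \<inter> V. (x, y) \<notin> E) \<and> (x = u \<longrightarrow> a \<notin> I \<and> c \<notin> I)"
        if "x \<in> V" for x
        unfolding I(1) I(5)[OF that] using mem_mis_iff[OF J(2) that] I(2,3) by blast
      moreover have "I \<subseteq> ?V" using J(1) JV by blast
      ultimately show ?thesis unfolding mis_iff using I(2-4) by blast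
    next
      assume "I \<in> (\<union>) ({c} \<union> W) ` mis (V - {u}) E"
      then obtain J where J: "I = ({c} \<union> W) \<union> J" "J \<in> mis (V - {u}) E" by blast
      note JV = mis_subset[OF J(2)]
      have I: "I \<inter> V = J" "b \<notin> I" "u \<notin> I" "c \<in> I" "W = {a} \<Longrightarrow> a \<in> I"
          "\<And>x. x \<in> V \<Longrightarrow> x \<in> I \<longleftrightarrow> x \<in> J"
        using J(1) JV new ne W u by auto
      have "x \<in> I \<longleftrightarrow> (\<forall>y\<in>I \<inter> V. (x, y) \<notin> E) \<and> (x = u \<longrightarrow> a \<notin> I \<and> c \<notin> I)"
        if "x \<in> V" for x
      proof (cases "x = u")
        case False
        then have "x \<in> V - {u}" using that by blast
        from mem_mis_iff[OF J(2) this] False show ?thesis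
          unfolding I(1) I(6)[OF that] by blast
      qed (use I(3,4) in blast)
      moreover have "I \<subseteq> ?V" using J(1) JV by blast
      ultimately show ?thesis unfolding mis_iff using I(2-5) by blast
    qed
  qed
qed (use new dist W in auto)

lemma four_cycle_through_arc:
  assumes "four_cycle B" "(u, v) \<in> parcs B"
  obtains w x where "distinct [u, v, w, x]" "pverts B = {u, v, w, x}"
    "parcs B = square_arcs u v w x"
proof -
  obtain a b c d where abcd: "distinct [a, b, c, d]"
      and V: "pverts B = {a, b, c, d}" and A: "parcs B = square_arcs a b c d"
    using assms(1) unfolding four_cycle_def by auto
  have "(u, v) \<in> square_arcs a b c d" using assms(2) A by simp
  then consider "u = a" "v = b" | "u = b" "v = a" | "u = b" "v = c" | "u = c" "v = b"
    | "u = c" "v = d" | "u = d" "v = c" | "u = d" "v = a" | "u = a" "v = d"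
    by blast
  then show thesis
  proof cases
    case 1 show thesis by (rule that[of c d]) (use abcd V A 1 in auto)
  next
    case 2 show thesis by (rule that[of d c]) (use abcd V A 2 in auto)
  next
    case 3 show thesis by (rule that[of d a]) (use abcd V A 3 in auto)
  next
    case 4 show thesis by (rule that[of a d]) (use abcd V A 4 in auto)
  next
    case 5 show thesis by (rule that[of a b]) (use abcd V A 5 in auto)
  next
    case 6 show thesis by (rule that[of b a]) (use abcd V A 6 in auto)
  next
    case 7 show thesis by (rule that[of b c]) (use abcd V A 7 in auto)
  next
    case 8 show thesis by (rule that[of c b]) (use abcd V A 8 in auto)
  qed
qed

lemma four_cycle_neighbour:
  assumes "four_cycle B" "v \<in> pverts B"
  shows "\<exists>u. (u, v) \<in> parcs B \<and> (v, u) \<in> parcs B"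
  using assms unfolding four_cycle_def by auto

lemma four_cycle_wf:
  assumes "four_cycle B"
  shows "finite (pverts B)" "parcs B \<subseteq> pverts B \<times> pverts B" "pverts B \<noteq> {}"
  using assms unfolding four_cycle_def by auto

lemma num_maximal_independent_sets_square_cactus:
  assumes "square_cactus n G"
  shows "num_maximal_independent_sets G = 2 ^ n"
proof -
  obtain B where "n \<ge> 1"
    and cyc: "\<forall>i\<in>{1..n}. four_cycle (B i)"
    and VG: "pverts G = (\<Union>i\<in>{1..n}. pverts (B i))"
    and EG: "parcs G = (\<Union>i\<in>{1..n}. parcs (B i))"
    and one: "\<forall>i\<in>{1..<n}. card (pverts (B i) \<inter> pverts (B (i + 1))) = 1"
    and far: "\<forall>i\<in>{1..n}. \<forall>j\<in>{1..n}. i + 1 < j \<longrightarrow> pverts (B i) \<inter> pverts (B j) = {}"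
    and adj: "\<forall>i\<in>{2..<n}. \<forall>u \<in> pverts (B (i - 1)) \<inter> pverts (B i).
      \<forall>v \<in> pverts (B i) \<inter> pverts (B (i + 1)). (u, v) \<in> parcs G"
    using assms unfolding square_cactus_def by (elim conjE exE) (rule that, assumption+)
  note cyc = bspec[OF cyc] and one = bspec[OF one]
    and far = mp[OF bspec[OF bspec[OF far]]] and adj = bspec[OF bspec[OF bspec[OF adj]]]
  define V where "V m = (\<Union>i\<in>{1..m}. pverts (B i))" for m
  define E where "E m = (\<Union>i\<in>{1..m}. parcs (B i))" for m
  note wf = four_cycle_wf[OF cyc]
  have finV: "finite (V m)" if "m \<le> n" for m
    using that wf(1) by (auto simp: V_def)
  have EV: "E m \<subseteq> V m \<times> V m" if "m \<le> n" for m
    using that wf(2) unfolding V_def E_def by fastforce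
  have adj': "(u, v) \<in> parcs (B i)" if i: "i \<in> {2..<n}" and
      u: "u \<in> pverts (B (i - 1)) \<inter> pverts (B i)" and
      v: "v \<in> pverts (B i) \<inter> pverts (B (i + 1))" for i u v
  proof -
    obtain j where j: "j \<in> {1..n}" "(u, v) \<in> parcs (B j)"
      using adj[OF i u v] EG by blast
    then have uv: "u \<in> pverts (B j)" "v \<in> pverts (B j)" using wf(2) by blast+
    have "i - 1 \<in> {1..n}" using i by auto
    then have "\<not> i - 1 + 1 < j" using far[of "i - 1" j] u uv j by blast
    moreover have "\<not> j + 1 < i + 1" using far[of j "i + 1"] v uv i j by auto
    ultimately have "j = i" using i by auto
    with j show ?thesis by simp
  qed
  have main: "card (mis (V m) (E m)) = 2 ^ m \<and> card (mis (V m - {v}) (E m)) = 2 ^ m"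
    if "1 \<le> m" "m \<le> n" "v \<in> pverts (B m)"
      "2 \<le> m \<Longrightarrow> \<forall>u \<in> pverts (B (m - 1)) \<inter> pverts (B m). (u, v) \<in> parcs (B m)" for m v
    using that
  proof (induction m arbitrary: v rule: nat_induct_at_least)
    case base
    obtain u where "(u, v) \<in> parcs (B 1)"
      using four_cycle_neighbour[OF cyc[of 1]] base by auto
    then obtain w x where d: "distinct [u, v, w, x]" and p: "pverts (B 1) = {u, v, w, x}"
      "parcs (B 1) = square_arcs u v w x"
      using four_cycle_through_arc[OF cyc[of 1]] base by (metis atLeastAtMost_iff order_refl)
    have 1: "V 1 = {u} \<union> {w, x} \<union> {v}" "V 1 - {v} = {u} \<union> {w, x} \<union> {}"
      "E 1 = {} \<union> square_arcs u v w x"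
      using p d by (auto simp: V_def E_def)
    have point: "mis {u} {} = {{u}}" "mis ({u} - {u}) {} = {{}}"
      by (auto simp: mis_def)
    show ?case
      unfolding 1(2) unfolding 1
      using card_mis_glue_square[of "{u}" "{}" u v w x "{v}"]
        card_mis_glue_square[of "{u}" "{}" u v w x "{}"] d
      unfolding point by auto
  next
    case (Suc m)
    then have m: "m \<in> {1..<n}" "m \<in> {1..n}" "Suc m \<in> {1..n}" by auto
    obtain u where u: "pverts (B m) \<inter> pverts (B (Suc m)) = {u}"
      using one[OF m(1)] by (auto simp: card_1_singleton_iff)
    have IH: "card (mis (V m) (E m)) = 2 ^ m \<and> card (mis (V m - {u}) (E m)) = 2 ^ m"
    proof (rule Suc.IH)
      show "\<forall>t \<in> pverts (B (m - 1)) \<inter> pverts (B m). (t, u) \<in> parcs (B m)" if "2 \<le> m"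
        using adj'[of m _ u] that m u by auto
    qed (use u m in auto)
    have "(u, v) \<in> parcs (B (Suc m))" using Suc.prems(3) Suc.hyps u by auto
    then obtain w x where d: "distinct [u, v, w, x]" and p: "pverts (B (Suc m)) = {u, v, w, x}"
      "parcs (B (Suc m)) = square_arcs u v w x"
      using four_cycle_through_arc[OF cyc[OF m(3)]] by metis
    have uV: "u \<in> V m" using u m by (auto simp: V_def)
    have "V m \<inter> pverts (B (Suc m)) \<subseteq> {u}"
    proof
      fix t assume "t \<in> V m \<inter> pverts (B (Suc m))"
      then obtain i where i: "i \<in> {1..m}" "t \<in> pverts (B i)" "t \<in> pverts (B (Suc m))"
        by (auto simp: V_def)
      then have "\<not> i + 1 < Suc m" using far[of i "Suc m"] m by auto
      with i have "i = m" by auto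
      with i u show "t \<in> {u}" by auto
    qed
    with p d have new: "v \<notin> V m" "w \<notin> V m" "x \<notin> V m" by auto
    have "V (Suc m) = V m \<union> pverts (B (Suc m))" "E (Suc m) = E m \<union> parcs (B (Suc m))"
      by (auto simp: V_def E_def atLeastAtMostSuc_conv)
    with p d uV new have *: "V (Suc m) = V m \<union> {w, x} \<union> {v}"
        "V (Suc m) - {v} = V m \<union> {w, x} \<union> {}" "E (Suc m) = E m \<union> square_arcs u v w x"
      by auto
    have "m \<le> n" using m by simp
    have "distinct [v, w, x]" using d by simp
    note glue = finV[OF \<open>m \<le> n\<close>] EV[OF \<open>m \<le> n\<close>] uV new this
    show ?case
      unfolding *(2) unfolding *(1,3) card_mis_glue_square[OF glue subset_refl]
        card_mis_glue_square[OF glue empty_subsetI] using IH by simp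
  qed
  have "\<exists>v \<in> pverts (B n). 2 \<le> n \<longrightarrow>
      (\<forall>u \<in> pverts (B (n - 1)) \<inter> pverts (B n). (u, v) \<in> parcs (B n))"
  proof (cases "2 \<le> n")
    case True
    then have "card (pverts (B (n - 1)) \<inter> pverts (B n)) = 1" using one[of "n - 1"] by simp
    then obtain u where u: "pverts (B (n - 1)) \<inter> pverts (B n) = {u}"
      by (auto simp: card_1_singleton_iff)
    moreover obtain v where "(u, v) \<in> parcs (B n)"
      using four_cycle_neighbour[of "B n" u] cyc[of n] True u by auto
    moreover from this have "v \<in> pverts (B n)" using wf(2)[of n] True by auto
    ultimately show ?thesis by auto
  qed (use wf(3)[of n] \<open>n \<ge> 1\<close> in auto)
  then have "card (mis (V n) (E n)) = 2 ^ n" using main[of n] \<open>n \<ge> 1\<close> by blast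
  then show ?thesis
    unfolding num_maximal_independent_sets_def
      maximal_independent_sets_eq_mis[OF square_cactus_pair_graph[OF assms]]
    by (simp add: VG EG V_def E_def)
qed

theorem theorem2p8:
  fixes S :: "nat \<Rightarrow> 'a pair_pre_digraph" and s :: "nat \<Rightarrow> nat"
  assumes "\<And>n. n \<ge> 1 \<Longrightarrow> square_cactus n (S n)"
    and "\<And>n. n \<ge> 1 \<Longrightarrow> s n = num_maximal_independent_sets (S n)"
  shows "s 1 = 2 \<and> (\<forall>n\<ge>2. s n = 2 * s (n - 1)) \<and> (\<forall>n\<ge>1. s n = 2 ^ n)"
proof -
  have s: "s n = 2 ^ n" if "n \<ge> 1" for n
    using assms that by (simp add: num_maximal_independent_sets_square_cactus)
  have "s n = 2 * s (n - 1)" if "n \<ge> 2" for n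
    using that s[of n] s[of "n - 1"] by (simp flip: power_Suc)
  with s show ?thesis by simp
qed

end
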